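(* Let $(\mathbf{v},\mathbf{B})\in\mathcal{D}_n$ and let $\mathbf{A}=(A_1,\ldots,A_n)\in(\mathbb{R}^{d\times d})^n$ be a tuple of symmetric positive-definite matrices. Define $H_{\mathbf{A}}:\mathbb{R}^{nd}\to\mathbb{R}$ by $$H_{\mathbf{A}}(\mathbf{X})=\tfrac12\mathcal{T}_{\mathbf{A}}(\mathbf{X},\mathbf{v})-\tfrac12\sum_{i=1}^n v_i|x_i|_{A_i}^2+\sum_{i=1}^n v_i\,x_i\cdot(A_ib_i).$$ If $\mathbf{X}\in\mathbb{D}_n$, then $$H_{\mathbf{A}}(\mathbf{X})=\tfrac12\sum_{i=1}^n\int_{L_i^{\mathbf{A}}(\mathbf{X};\mathbf{v})}|x-x_i|_{A_i}^2\,dx-\tfrac12\sum_{i=1}^n v_i|x_i|_{A_i}^2+\sum_{i=1}^n v_i\,x_i\cdot(A_ib_i).$$ Moreover, $H_{\mathbf{A}}$ is concave, it is continuously differentiable on the set of distinct seeds, $H_{\mathbf{A}}\in C^1(\mathbb{D}_n)$, and for all $\mathbf{X}\in\mathbb{D}_n$ its gradient is given by $$\frac{\partial H_{\mathbf{A}}}{\partial x_i}(\mathbf{X})=v_iA_i\big(b_i-c_i(\mathbf{X};\mathbf{v},\mathbf{A})\big)\quad\forall\, i\in\{1,\ldots,n\}.$$ In particular, for $\mathbf{X}\in\mathbb{D}_n$, $\nabla H_{\mathbf{A}}(\mathbf{X})=0$ if and only if $\mathbf{X}$ generates an anisotropic Laguerre tessellation with anisotropy matrices $A_i$ and cells of volume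 $v_i$ and centroids $b_i$, i.e. $c_i(\mathbf{X};\mathbf{v},\mathbf{A})=b_i$ for all $i$.
   Context: Let $d\ge 2$ and let $\Omega\subset\mathbb{R}^d$ be a non-empty, convex, bounded set equal to the closure of its interior. For a Lebesgue-measurable $E\subseteq\mathbb{R}^d$, $\mathrm{vol}(E)$ is its $d$-dimensional Lebesgue measure and, if $\mathrm{vol}(E)\neq 0$, $\sigma(E)=\frac{1}{\mathrm{vol}(E)}\int_E x\,dx$ is its centroid. $\mathbb{D}_n=\{\mathbf{X}=(x_1,\ldots,x_n)\in(\mathbb{R}^d)^n : x_i\ne x_j \text{ for all } i\neq j\}$; $(\mathbb{R}^d)^n$ is identified with $\mathbb{R}^{nd}$. $\mathbb{V}_n=\{\mathbf{v}\in(0,\infty)^n : \sum_{i=1}^n v_i=\mathrm{vol}(\Omega)\}$, and $$\mathcal{D}_n=\Big\{(\mathbf{v},\mathbf{B})=((v_1,\ldots,v_n),(b_1,\ldots,b_n))\in\mathbb{V}_n\times\Omega^n : \sum_{i=1}^n v_ib_i=\mathrm{vol}(\Omega)\,\sigma(\Omega)\Big\}.$$ For a symmetric positive-definite matrix $A$, $|x|_A=(x\cdot Ax)^{1/2}$. For $\mathbf{X}\in\mathbb{D}_n$, $\mathbf{w}\in\mathbb{R}^n$ and a tuple $\mathbf{A}=(A_1,\ldots,A_n)$ of symmetric positive-definite $d\times d$ matrices, the $i$-th anisotropic Laguerre cell is $$\mathrm{Lag}_i^{\mathbf{A}}(\mathbf{X},\mathbf{w})=\{x\in\Omega : |x-x_i|_{A_i}^2-w_i\le|x-x_j|_{A_j}^2-w_j\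 \forall j\in\{1,\ldots,n\}\}.$$ The anisotropic optimal transport cost is, for $\mathbf{X}\in\mathbb{R}^{nd}$ and $\mathbf{v}\in\mathbb{V}_n$, $$\mathcal{T}_{\mathbf{A}}(\mathbf{X},\mathbf{v})=\inf\sum_{i=1}^n\int_{\Omega_i}|x-x_i|_{A_i}^2\,dx,$$ where the infimum is over all measurable partitions $(\Omega_1,\ldots,\Omega_n)$ of $\Omega$ with $\mathrm{vol}(\Omega_i)=v_i$ for all $i$ (for distinct seeds this is the same as the infimum over maps $T:\Omega\to\{x_1,\ldots,x_n\}$ with $\mathrm{vol}(T^{-1}(\{x_i\}))=v_i$, with $\Omega_i=T^{-1}(\{x_i\})$). For $\mathbf{X}\in\mathbb{D}_n$ and $\mathbf{v}\in\mathbb{V}_n$ it is known that there exists $\mathbf{w}^\star(\mathbf{X};\mathbf{v},\mathbf{A})\in\mathbb{R}^n$, unique up to adding the same constant to all components, such that $\mathrm{vol}(\mathrm{Lag}_i^{\mathbf{A}}(\mathbf{X},\mathbf{w}^\star(\mathbf{X};\mathbf{v},\mathbf{A})))=v_i$ for all $i$, and that the corresponding cells form (up to null sets) the optimal partition for $\mathcal{T}_{\mathbf{A}}(\mathbf{X},\mathbf{v})$. Set $L_i^{\mathbf{A}}(\mathbf{X};\mathbf{v})=\mathrm{Lag}_i^{\mathbf{A}}(\mathbf{X},\mathbf{w}^\star(\mathbf{X};\mathbf{v},\mathbf{A}))$ and $c_i(\mathbf{X};\mathbf{v},\mathbf{A})=\sigma(L_i^{\mathbf{A}}(\mathbf{X};\mathbf{v}))$.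 *)

theory Defs
  imports "HOL-Analysis.Analysis"
begin

text \<open>
  The finite type \<open>'d\<close> indexes the coordinates of the ambient space and \<open>'n\<close> indexes the seeds;
  tuples of seeds live in \<^typ>\<open>real^'d^'n\<close>, whose Euclidean structure is that of the
  \<open>(n * d)\<close>-dimensional space. Thus \<open>X $ i\<close> is the seed \<open>x\<^sub>i\<close>.
\<close>

section \<open>Differentiability of scalar functions\<close>

text \<open>Meaningful only where \<open>f\<close> is differentiable; there the gradient is unique.\<close>

definition gradient :: "('a::euclidean_space \<Rightarrow> real) \<Rightarrow> 'a \<Rightarrow> 'a" where
  "gradient f x = (THE D. GDERIV f x :> D)"

definition continuously_differentiable_on ::
    "('a::euclidean_space \<Rightarrow> real) \<Rightarrow> 'a set \<Rightarrow> bool" where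
  "continuously_differentiable_on f U \<longleftrightarrow>
     (\<forall>x\<in>U. f differentiable (at x)) \<and> continuous_on U (gradient f)"

lemma gradient_eqI:
  assumes "GDERIV f x :> D"
  shows "gradient f x = D"
  unfolding gradient_def
proof (rule the_equality)
  fix E assume "GDERIV f x :> E"
  then have "(\<lambda>h. inner h E) = (\<lambda>h. inner h D)"
    using assms has_derivative_unique unfolding gderiv_def by blast
  then have "inner (E - D) (E - D) = 0"
    by (metis inner_diff_right right_minus_eq)
  then show "E = D"
    by simp
qed (fact assms)

lemma differentiable_gradient:
  assumes "f differentiable (at x)"
  shows "GDERIV f x :> gradient f x"
proof -
  obtain f' where f': "(f has_derivative f') (at x)"
    using assms unfolding differentiable_def by blast
  have "linear f'"
    using f' by (rule has_derivative_linear)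
  then have "f' = (\<lambda>h. inner h (adjoint f' 1))"
    by (simp add: adjoint_works fun_eq_iff)
  then have "GDERIV f x :> adjoint f' 1"
    using f' unfolding gderiv_def by simp
  then show ?thesis
    by (simp add: gradient_eqI)
qed

section \<open>Anisotropic norms and centroids\<close>

definition sym_pos_def :: "real^'d^'d \<Rightarrow> bool" where
  "sym_pos_def M \<longleftrightarrow> transpose M = M \<and> (\<forall>x. x \<noteq> 0 \<longrightarrow> x \<bullet> (M *v x) > 0)"

definition anorm :: "real^'d^'d \<Rightarrow> real^'d \<Rightarrow> real" where
  "anorm M x = sqrt (x \<bullet> (M *v x))"

abbreviation vol :: "(real^'d) set \<Rightarrow> real" where
  "vol \<equiv> measure lebesgue"

definition centroid :: "(real^'d) set \<Rightarrow> real^'d" where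
  "centroid E = (1 / vol E) *\<^sub>R (LINT x:E|lebesgue. x)"

section \<open>Seeds, volumes and barycentres\<close>

definition distinct_seeds :: "(real^'d^'n) set" where
  "distinct_seeds = {X. \<forall>i j. i \<noteq> j \<longrightarrow> X $ i \<noteq> X $ j}"

definition volume_vectors :: "(real^'d) set \<Rightarrow> (real^'n) set" where
  "volume_vectors \<Omega> = {v. (\<forall>i. v $ i > 0) \<and> (\<Sum>i\<in>UNIV. v $ i) = vol \<Omega>}"

definition compatible_data :: "(real^'d) set \<Rightarrow> ((real^'n) \<times> (real^'d^'n)) set" where
  "compatible_data \<Omega> =
     {(v, B). v \<in> volume_vectors \<Omega> \<and> (\<forall>i. B $ i \<in> \<Omega>) \<and>
        (\<Sum>i\<in>UNIV. v $ i *\<^sub>R B $ i) = vol \<Omega> *\<^sub>R centroid \<Omega>}"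

section \<open>Laguerre tessellations and optimal transport\<close>

definition laguerre_cell ::
    "(real^'d) set \<Rightarrow> real^'d^'d^'n \<Rightarrow> real^'d^'n \<Rightarrow> real^'n \<Rightarrow> 'n \<Rightarrow> (real^'d) set" where
  "laguerre_cell \<Omega> A X w i =
     {x \<in> \<Omega>. \<forall>j. (anorm (A $ i) (x - X $ i))\<^sup>2 - w $ i \<le> (anorm (A $ j) (x - X $ j))\<^sup>2 - w $ j}"

definition volume_partitions :: "(real^'d) set \<Rightarrow> real^'n \<Rightarrow> ('n \<Rightarrow> (real^'d) set) set" where
  "volume_partitions \<Omega> v =
     {P. (\<forall>i. P i \<in> sets lebesgue) \<and> disjoint_family P \<and> (\<Union>i. P i) = \<Omega> \<and> (\<forall>i. vol (P i) = v $ i)}"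

definition transport_cost ::
    "(real^'d) set \<Rightarrow> real^'d^'d^'n \<Rightarrow> real^'d^'n \<Rightarrow> real^'n \<Rightarrow> real" where
  "transport_cost \<Omega> A X v =
     (INF P\<in>volume_partitions \<Omega> v.
        \<Sum>i\<in>UNIV. LINT x:P i|lebesgue. (anorm (A $ i) (x - X $ i))\<^sup>2)"

text \<open>
  For distinct seeds and \<open>v\<close> in \<^const>\<open>volume_vectors\<close>, weights as below exist and are unique up to
  adding one constant to all components, which does not change the cells; the choice is immaterial.
\<close>

definition optimal_weights ::
    "(real^'d) set \<Rightarrow> real^'d^'d^'n \<Rightarrow> real^'d^'n \<Rightarrow> real^'n \<Rightarrow> real^'n" where
  "optimal_weights \<Omega> A X v = (SOME w. \<forall>i. vol (laguerre_cell \<Omega> A X w i) = v $ i)"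

definition optimal_cell ::
    "(real^'d) set \<Rightarrow> real^'d^'d^'n \<Rightarrow> real^'d^'n \<Rightarrow> real^'n \<Rightarrow> 'n \<Rightarrow> (real^'d) set" where
  "optimal_cell \<Omega> A X v i = laguerre_cell \<Omega> A X (optimal_weights \<Omega> A X v) i"

definition cell_centroid ::
    "(real^'d) set \<Rightarrow> real^'d^'d^'n \<Rightarrow> real^'d^'n \<Rightarrow> real^'n \<Rightarrow> 'n \<Rightarrow> real^'d" where
  "cell_centroid \<Omega> A X v i = centroid (optimal_cell \<Omega> A X v i)"

definition generates_tessellation ::
    "(real^'d) set \<Rightarrow> real^'d^'d^'n \<Rightarrow> real^'d^'n \<Rightarrow> real^'n \<Rightarrow> real^'d^'n \<Rightarrow> bool" where
  "generates_tessellation \<Omega> A X v B \<longleftrightarrow>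
     (\<exists>w. \<forall>i. vol (laguerre_cell \<Omega> A X w i) = v $ i \<and> centroid (laguerre_cell \<Omega> A X w i) = B $ i)"

definition H_fun ::
    "(real^'d) set \<Rightarrow> real^'d^'d^'n \<Rightarrow> real^'n \<Rightarrow> real^'d^'n \<Rightarrow> real^'d^'n \<Rightarrow> real" where
  "H_fun \<Omega> A v B X =
     1/2 * transport_cost \<Omega> A X v
     - 1/2 * (\<Sum>i\<in>UNIV. v $ i * (anorm (A $ i) (X $ i))\<^sup>2)
     + (\<Sum>i\<in>UNIV. v $ i * (X $ i \<bullet> (A $ i *v B $ i)))"

end

theory Submission
  imports Defs
begin

text \<open>
  For a fixed partition of \<open>\<Omega>\<close> with the prescribed volumes, the quadratic terms in the seeds cancel
  from the functional, so that \<open>H\<close> is an infimum of affine functions of the seeds, hence concave. At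
  distinct seeds the infimum is attained by the Laguerre cells of the right volumes, so the slope of
  the corresponding affine function is a supergradient there. Ties between two cost functions lie on
  null sets, so integrals over cells depend continuously on seeds and weights; since cells of given
  volumes are unique up to null sets, a compactness argument for the weights makes the supergradient
  continuous, and a function with a continuous supergradient on an open set is continuously
  differentiable. Weights with the right volumes maximise the concave dual functional.
\<close>

section \<open>Null sets and supergradients\<close>

text \<open>
  Each point lies in at most \<open>m\<close> of the translates of \<open>S\<close> along \<open>u\<close>, while infinitely many translates
  of a compact piece of \<open>S\<close> fit into a bounded region.
\<close>

lemma negligible_if_finite_on_parallel_lines:
  fixes S :: "'a::euclidean_space set"
  assumes "closed S"
    and fin: "\<And>x. finite {t. x + t *\<^sub>R u \<in> S}"
    and card: "\<And>x. card {t. x + t *\<^sub>R u \<in> S} \<le> m"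
  shows "negligible S"
proof (subst negligible_on_intervals, intro allI)
  fix a b :: 'a
  define T where "T = S \<inter> cbox a b"
  \<comment> \<open>Infinitely many distinct shifts in \<open>{0..1}\<close>, so that every
    translate \<open>V k\<close> lies in the compact set \<open>U\<close>.\<close>
  define t :: "nat \<Rightarrow> real" where "t k = 1 / (real k + 1)" for k
  define U where "U = (\<lambda>z. snd z + fst z *\<^sub>R u) ` ({0..1} \<times> T)"
  have "compact T"
    unfolding T_def using \<open>closed S\<close> by (simp add: closed_Int_compact)
  moreover have "compact U"
    unfolding U_def
    by (intro compact_continuous_image compact_Times continuous_intros \<open>compact T\<close> compact_Icc)
  ultimately have T: "T \<in> lmeasurable" and U: "U \<in> lmeasurable"
    by (simp_all add: lmeasurable_compact)
  define V where "V k = (+) (t k *\<^sub>R u) ` T" for k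
  have V: "V k \<in> lmeasurable" "measure lebesgue (V k) = measure lebesgue T" for k
    unfolding V_def using T by (simp_all add: measurable_translation measure_translation)
  have le: "(\<Sum>k<N. indicator (V k) x) \<le> real m * indicator U x" for N x
  proof (cases "x \<in> U")
    case True
    have "(\<Sum>k<N. indicator (V k) x) = real (card {k\<in>{..<N}. x \<in> V k})"
      by (simp add: indicator_def sum.If_cases Int_def)
    \<comment> \<open>If \<open>x\<close> is in \<open>V k\<close>, moving back by
      \<open>t k\<close> lands in \<open>S\<close>; distinct \<open>k\<close> give distinct
      parameters \<open>- t k\<close> on the line through \<open>x\<close>.\<close>
    also have "card {k\<in>{..<N}. x \<in> V k} \<le> card {s. x + s *\<^sub>R u \<in> S}"
    proof (rule card_inj_on_le[OF _ _ fin])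
      show "inj_on (\<lambda>k. - t k) {k\<in>{..<N}. x \<in> V k}"
        by (auto simp: inj_on_def t_def)
    qed (auto simp: V_def T_def)
    also have "\<dots> \<le> m" by (rule card)
    finally show ?thesis using True by simp
  next
    case False
    have "x \<notin> V k" for k
    proof
      assume "x \<in> V k"
      then obtain y where "y \<in> T" "x = y + t k *\<^sub>R u"
        by (auto simp: V_def add.commute)
      then have "x \<in> U" by (auto simp: U_def t_def intro!: image_eqI[of _ _ "(t k, y)"])
      with False show False ..
    qed
    then show ?thesis by simp
  qed
  have int: "integrable lebesgue (indicator E :: 'a \<Rightarrow> real)" if "E \<in> lmeasurable" for E
    using that by (intro integrable_real_indicator) (auto simp: fmeasurable_def)
  have bound: "real N * measure lebesgue T \<le> real m * measure lebesgue U" for N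
  proof -
    have "real N * measure lebesgue T = (\<Sum>k<N. measure lebesgue (V k))"
      by (simp add: V)
    also have "\<dots> = (\<Sum>k<N. LINT x|lebesgue. indicator (V k) x)"
      by simp
    also have "\<dots> = (LINT x|lebesgue. (\<Sum>k<N. indicator (V k) x))"
      by (subst Bochner_Integration.integral_sum) (auto intro: int V)
    also have "\<dots> \<le> (LINT x|lebesgue. real m * indicator U x)"
      by (intro integral_mono Bochner_Integration.integrable_sum integrable_mult_right int U V le)
    also have "\<dots> = real m * measure lebesgue U"
      by simp
    finally show ?thesis .
  qed
  have "measure lebesgue T = 0"
  proof (rule ccontr)
    assume "measure lebesgue T \<noteq> 0"
    then have "measure lebesgue T > 0" by (simp add: zero_less_measure_iff)
    then obtain N :: nat where "real m * measure lebesgue U < real N * measure lebesgue T"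
      using reals_Archimedean3 by blast
    with bound[of N] show False by simp
  qed
  then show "negligible (S \<inter> cbox a b)"
    using T by (simp add: negligible_iff_measure T_def)
qed

section \<open>Tie sets of two anisotropic costs\<close>

lemma card_quadratic_roots:
  fixes \<alpha> \<beta> \<gamma> :: real
  assumes "\<beta> \<noteq> 0 \<or> \<gamma> \<noteq> 0"
  shows "finite {t. \<alpha> + \<beta> * t + \<gamma> * t\<^sup>2 = 0}" "card {t. \<alpha> + \<beta> * t + \<gamma> * t\<^sup>2 = 0} \<le> 2"
proof -
  have p: "[:\<alpha>, \<beta>, \<gamma>:] \<noteq> 0" using assms by auto
  have eq: "{t. \<alpha> + \<beta> * t + \<gamma> * t\<^sup>2 = 0} = {t. poly [:\<alpha>, \<beta>, \<gamma>:] t = 0}"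
    by (auto simp: algebra_simps power2_eq_square)
  show "finite {t. \<alpha> + \<beta> * t + \<gamma> * t\<^sup>2 = 0}"
    unfolding eq by (rule poly_roots_finite[OF p])
  have "card {t. poly [:\<alpha>, \<beta>, \<gamma>:] t = 0} \<le> degree [:\<alpha>, \<beta>, \<gamma>:]"
    by (rule card_poly_roots_bound[OF p])
  also have "\<dots> \<le> 2" by simp
  finally show "card {t. \<alpha> + \<beta> * t + \<gamma> * t\<^sup>2 = 0} \<le> 2"
    unfolding eq .
qed

lemma symmetric_matrix_inner:
  fixes M :: "real^'d^'d"
  assumes "transpose M = M"
  shows "x \<bullet> (M *v y) = y \<bullet> (M *v x)"
  by (metis assms dot_lmul_matrix inner_commute transpose_matrix_vector)

text \<open>Polarisation: the values of the quadratic form at \<open>x + y\<close>, \<open>x\<close>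
  and \<open>y\<close> determine the bilinear form.\<close>

lemma symmetric_matrix_eqI:
  fixes M N :: "real^'d^'d"
  assumes M: "transpose M = M" and N: "transpose N = N"
    and eq: "\<And>u. u \<bullet> (M *v u) = u \<bullet> (N *v u)"
  shows "M = N"
proof -
  have "x \<bullet> (M *v y) = x \<bullet> (N *v y)" for x y
    using eq[of "x + y"] eq[of x] eq[of y]
      symmetric_matrix_inner[OF M, of x y] symmetric_matrix_inner[OF N, of x y]
    by (simp add: matrix_vector_right_distrib inner_add)
  then show ?thesis
    by (metis matrix_eq vector_eq_rdot inner_commute)
qed

lemma anorm_power2:
  assumes "sym_pos_def M"
  shows "(anorm M x)\<^sup>2 = x \<bullet> (M *v x)"
proof -
  have "0 \<le> x \<bullet> (M *v x)"
    using assms by (cases "x = 0") (auto simp: sym_pos_def_def less_imp_le)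
  then show ?thesis by (simp add: anorm_def)
qed

lemma continuous_on_anorm_power2 [continuous_intros]:
  assumes "sym_pos_def M" "continuous_on S f"
  shows "continuous_on S (\<lambda>x. (anorm M (f x))\<^sup>2)"
  unfolding anorm_power2[OF assms(1)]
  by (intro continuous_intros assms(2) bounded_linear.continuous_on[OF matrix_vector_mul_bounded_linear])

text \<open>On every line in a suitable direction \<open>u\<close> the difference of the two sides
  is a nonzero polynomial of degree at most two, so the tie set meets each such line in at most two
  points.\<close>

lemma negligible_anorm_ties:
  fixes M N :: "real^'d^'d"
  assumes M: "sym_pos_def M" and N: "sym_pos_def N" and ne: "a \<noteq> b"
  shows "negligible {x. (anorm M (x - a))\<^sup>2 - r = (anorm N (x - b))\<^sup>2 - s}" (is "negligible ?S")
proof -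
  have tM: "transpose M = M" and tN: "transpose N = N"
    using M N by (auto simp: sym_pos_def_def)
  \<comment> \<open>If the matrices differ, some direction separates their quadratic forms and the
    leading coefficient is nonzero. If they agree, \<open>u = b - a\<close> makes the linear
    coefficient \<open>2 * (u \<bullet> (M *v u))\<close>, which is positive.\<close>
  obtain u where u: "u \<bullet> (M *v u) \<noteq> u \<bullet> (N *v u) \<or> (M = N \<and> u = b - a)"
    using symmetric_matrix_eqI[OF tM tN] by blast
  define \<alpha> where "\<alpha> x = (x - a) \<bullet> (M *v (x - a)) - r - ((x - b) \<bullet> (N *v (x - b)) - s)" for x
  define \<beta> where "\<beta> x = 2 * (u \<bullet> (M *v (x - a)) - u \<bullet> (N *v (x - b)))" for x
  define \<gamma> where "\<gamma> = u \<bullet> (M *v u) - u \<bullet> (N *v u)"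
  have "\<beta> x \<noteq> 0 \<or> \<gamma> \<noteq> 0" for x
  proof (cases "\<gamma> = 0")
    case True
    then have "M = N" "u = b - a" using u by (auto simp: \<gamma>_def)
    then have "\<beta> x = 2 * (u \<bullet> (M *v u))"
      by (simp add: \<beta>_def inner_diff_right matrix_vector_mult_diff_distrib)
    moreover have "u \<bullet> (M *v u) > 0"
      using M \<open>u = b - a\<close> ne by (auto simp: sym_pos_def_def)
    ultimately show ?thesis by simp
  qed simp
  have shift: "(x + t *\<^sub>R u - c) \<bullet> (K *v (x + t *\<^sub>R u - c)) =
      (x - c) \<bullet> (K *v (x - c)) + 2 * t * (u \<bullet> (K *v (x - c))) + t\<^sup>2 * (u \<bullet> (K *v u))"
    if "transpose K = K" for x t c and K :: "real^'d^'d"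
  proof -
    have "x + t *\<^sub>R u - c = (x - c) + t *\<^sub>R u" by simp
    then show ?thesis
      using symmetric_matrix_inner[OF that, of "x - c" u]
      by (simp only: matrix_vector_right_distrib matrix_vector_mult_scaleR inner_add_left
          inner_add_right inner_scaleR_left inner_scaleR_right)
         (simp add: algebra_simps power2_eq_square)
  qed
  have collect: "p + 2 * t * p' + t\<^sup>2 * p'' - r = q + 2 * t * q' + t\<^sup>2 * q'' - s \<longleftrightarrow>
      (p - r - (q - s)) + 2 * (p' - q') * t + (p'' - q'') * t\<^sup>2 = 0" for p p' p'' q q' q'' t
    by (auto simp: algebra_simps)
  have line: "{t. x + t *\<^sub>R u \<in> ?S} = {t. \<alpha> x + \<beta> x * t + \<gamma> * t\<^sup>2 = 0}" for x
    by (simp only: mem_Collect_eq anorm_power2[OF M] anorm_power2[OF N] shift[OF tM] shift[OF tN]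
        \<alpha>_def \<beta>_def \<gamma>_def collect)
  show ?thesis
  proof (rule negligible_if_finite_on_parallel_lines)
    show "closed ?S"
      by (intro closed_Collect_eq continuous_intros M N)
    show "finite {t. x + t *\<^sub>R u \<in> ?S}" "card {t. x + t *\<^sub>R u \<in> ?S} \<le> 2" for x
      unfolding line by (intro card_quadratic_roots \<open>\<beta> x \<noteq> 0 \<or> \<gamma> \<noteq> 0\<close>)+
  qed
qed

section \<open>Differentiability from a continuous supergradient\<close>

text \<open>The inequality read from \<open>x\<close> and again from \<open>y\<close> traps the
  first-order error between \<open>(g y - g x) \<bullet> (y - x)\<close> and 0; by Cauchy-Schwarz
  and continuity of \<open>g\<close> this is small compared with
  \<open>norm (y - x)\<close>.\<close>

lemma GDERIV_if_continuous_supergradient: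
  fixes f :: "'a::euclidean_space \<Rightarrow> real"
  assumes "open U" "x \<in> U" "continuous_on U g"
    and super: "\<And>x y. x \<in> U \<Longrightarrow> y \<in> U \<Longrightarrow> f y \<le> f x + g x \<bullet> (y - x)"
  shows "GDERIV f x :> g x"
  unfolding gderiv_def has_derivative_within
proof (intro conjI)
  show "bounded_linear (\<lambda>h. h \<bullet> g x)"
    by (rule bounded_linear_inner_left)
  have "isCont g x"
    using assms continuous_on_eq_continuous_at by blast
  then have g: "((\<lambda>y. norm (g y - g x)) \<longlongrightarrow> 0) (at x)"
    by (simp add: isCont_def LIM_zero_iff tendsto_norm_zero_iff)
  show "((\<lambda>y. (1 / norm (y - x)) *\<^sub>R (f y - (f x + (y - x) \<bullet> g x))) \<longlongrightarrow> 0) (at x)"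
  proof (rule Lim_null_comparison[OF _ g])
    have "\<forall>\<^sub>F y in at x. y \<in> U \<and> y \<noteq> x"
      using assms by (simp add: eventually_at_in_open eventually_conj_iff eventually_at_in_open' eventually_neq_at_within)
    then show "\<forall>\<^sub>F y in at x. norm ((1 / norm (y - x)) *\<^sub>R (f y - (f x + (y - x) \<bullet> g x))) \<le> norm (g y - g x)"
    proof eventually_elim
      case (elim y)
      have "f y \<le> f x + g x \<bullet> (y - x)" "f x \<le> f y + g y \<bullet> (x - y)"
        using super \<open>x \<in> U\<close> elim by auto
      then have "\<bar>f y - (f x + (y - x) \<bullet> g x)\<bar> \<le> \<bar>(g y - g x) \<bullet> (y - x)\<bar>"
        by (simp add: inner_diff_left inner_diff_right inner_commute)
      also have "\<dots> \<le> norm (g y - g x) * norm (y - x)"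
        by (rule Cauchy_Schwarz_ineq2)
      finally show ?case using elim by (simp add: field_simps)
    qed
  qed
qed

lemma open_distinct_seeds: "open (distinct_seeds :: (real^'d^'n) set)"
proof -
  have "distinct_seeds = (\<Inter>i. \<Inter>j\<in>{j. i \<noteq> j}. {X :: real^'d^'n. X $ i \<noteq> X $ j})"
    by (auto simp: distinct_seeds_def)
  moreover have "open \<dots>"
    by (intro open_INT finite open_Collect_neq ballI continuous_intros)
  ultimately show ?thesis by simp
qed

text \<open>Provides seeds from which some partition with the prescribed volumes can be built, also
  when the seeds under study coincide.\<close>

lemma distinct_seeds_nonempty: "\<exists>X :: real^'d^'n. X \<in> distinct_seeds"
proof -
  obtain f :: "'n \<Rightarrow> nat" where f: "inj f"
    using finite_imp_inj_to_nat_seg[OF finite[of UNIV]] by metis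
  have "(\<chi> i k. real (f i)) \<in> (distinct_seeds :: (real^'d^'n) set)"
    using f by (auto simp: distinct_seeds_def vec_eq_iff inj_eq)
  then show ?thesis ..
qed

section \<open>Partitions up to null sets\<close>

lemma set_integral_cong_set_AE:
  fixes f :: "'a::euclidean_space \<Rightarrow> 'b::euclidean_space"
  assumes f: "set_integrable lebesgue \<Omega> f"
    and S: "S \<in> sets lebesgue" "S \<subseteq> \<Omega>" and T: "T \<in> sets lebesgue" "T \<subseteq> \<Omega>"
    and ae: "AE x in lebesgue. x \<in> S \<longleftrightarrow> x \<in> T"
  shows "(LINT x:S|lebesgue. f x) = (LINT x:T|lebesgue. f x)"
proof -
  have "set_integrable lebesgue S f" "set_integrable lebesgue T f"
    using set_integrable_subset[OF f] S T by auto
  then have "set_borel_measurable lebesgue S f" "set_borel_measurable lebesgue T f"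
    by (simp_all add: set_integrable_def set_borel_measurable_def)
  from set_integral_cong_set[OF this ae] show ?thesis by simp
qed

lemma vol_eq_set_integral: "measure lebesgue S = (LINT x:S|lebesgue. 1)"
  by (simp add: set_lebesgue_integral_def)

text \<open>Laguerre cells can meet along their boundaries, so disjointness is asked only up to null
  sets.\<close>

definition ae_partition :: "'a::euclidean_space set \<Rightarrow> ('n::finite \<Rightarrow> 'a set) \<Rightarrow> bool" where
  "ae_partition \<Omega> P \<longleftrightarrow>
     (\<forall>i. P i \<in> sets lebesgue) \<and> (\<Union>i. P i) = \<Omega> \<and> (\<forall>i j. i \<noteq> j \<longrightarrow> negligible (P i \<inter> P j))"

lemma ae_partitionD:
  assumes "ae_partition \<Omega> P"
  shows "P i \<in> sets lebesgue" "P i \<subseteq> \<Omega>" "i \<noteq> j \<Longrightarrow> negligible (P i \<inter> P j)"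
  using assms by (auto simp: ae_partition_def)

lemma ae_partition_unique:
  assumes "ae_partition \<Omega> P"
  shows "AE x in lebesgue. x \<in> \<Omega> \<longrightarrow> (\<exists>!i. x \<in> P i)"
proof -
  define N where "N = (\<Union>(i, j)\<in>{(i, j). i \<noteq> j}. P i \<inter> P j)"
  have "negligible N"
    unfolding N_def using assms by (intro negligible_Union) (auto simp: ae_partition_def)
  then have "AE x in lebesgue. x \<notin> N"
    by (simp add: negligible_iff_null_sets AE_not_in)
  then show ?thesis
  proof eventually_elim
    case (elim x)
    with assms show ?case by (fastforce simp: ae_partition_def N_def)
  qed
qed

lemma sum_indicator_unique:
  fixes h :: "'n::finite \<Rightarrow> real"
  assumes "\<exists>!i. x \<in> P i" "x \<in> P k"
  shows "(\<Sum>i\<in>UNIV. indicator (P i) x * h i) = h k"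
proof -
  have "(\<Sum>i\<in>UNIV. indicator (P i) x * h i) = (\<Sum>i\<in>UNIV. if i = k then h i else 0)"
    using assms by (intro sum.cong) (auto simp: indicator_def)
  then show ?thesis by simp
qed

text \<open>Almost every point of \<Omega> lies in exactly one \<open>P p\<close> and one
  \<open>Q q\<close>, and there \<open>h q \<le> h p\<close>; integration gives the inequality. In
  the case of equality the nonnegative difference of the integrands vanishes almost everywhere, so
  \<open>p\<close> is a minimal index too.\<close>

lemma
  fixes h :: "'n::finite \<Rightarrow> 'a::euclidean_space \<Rightarrow> real"
  assumes P: "ae_partition \<Omega> P" and Q: "ae_partition \<Omega> Q"
    and int: "\<And>i. set_integrable lebesgue \<Omega> (h i)"
    and min: "\<And>i j x. x \<in> Q i \<Longrightarrow> h i x \<le> h j x"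
  shows ae_partition_integral_le:
      "(\<Sum>i\<in>UNIV. LINT x:Q i|lebesgue. h i x) \<le> (\<Sum>i\<in>UNIV. LINT x:P i|lebesgue. h i x)"
    and ae_partition_integral_eqD:
      "(\<Sum>i\<in>UNIV. LINT x:Q i|lebesgue. h i x) = (\<Sum>i\<in>UNIV. LINT x:P i|lebesgue. h i x) \<Longrightarrow>
       AE x in lebesgue. x \<in> P i \<longrightarrow> (\<forall>j. h i x \<le> h j x)"
proof -
  \<comment> \<open>Almost everywhere in \<Omega> this is the cost \<open>h i x\<close> of the only
    index \<open>i\<close> whose set contains \<open>x\<close>.\<close>
  define s where "s R x = (\<Sum>i\<in>UNIV. indicator (R i) x * h i x)" for R :: "'n \<Rightarrow> 'a set" and x
  have s_int: "integrable lebesgue (s R)"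
    and s_eq: "(\<Sum>i\<in>UNIV. LINT x:R i|lebesgue. h i x) = (LINT x|lebesgue. s R x)"
    if R: "ae_partition \<Omega> R" for R
  proof -
    have int_i: "integrable lebesgue (\<lambda>x. indicator (R i) x * h i x)" for i
      using set_integrable_subset[OF int[of i] ae_partitionD(1,2)[OF R, of i]]
      by (simp add: set_integrable_def)
    then show "integrable lebesgue (s R)"
      unfolding s_def by (intro Bochner_Integration.integrable_sum)
    show "(\<Sum>i\<in>UNIV. LINT x:R i|lebesgue. h i x) = (LINT x|lebesgue. s R x)"
      unfolding s_def using int_i
      by (subst Bochner_Integration.integral_sum) (auto simp: set_lebesgue_integral_def)
  qed
  have ae: "AE x in lebesgue. 0 \<le> s P x - s Q x \<and>
      (s P x - s Q x = 0 \<longrightarrow> (\<forall>i. x \<in> P i \<longrightarrow> (\<forall>j. h i x \<le> h j x)))"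
    using ae_partition_unique[OF P] ae_partition_unique[OF Q]
  proof eventually_elim
    case (elim x)
    show ?case
    proof (cases "x \<in> \<Omega>")
      case True
      with elim have uniq: "\<exists>!i. x \<in> P i" "\<exists>!i. x \<in> Q i" by simp_all
      then obtain p q where pq: "x \<in> P p" "x \<in> Q q" by blast
      have "s P x = h p x" "s Q x = h q x"
        unfolding s_def by (rule sum_indicator_unique, fact uniq, fact pq)+
      moreover have "h i x \<le> h j x" if "h p x = h q x" "x \<in> P i" for i j
      proof -
        have "i = p" using uniq(1) pq(1) that(2) by blast
        then show ?thesis using min[OF pq(2), of j] that(1) by simp
      qed
      ultimately show ?thesis using min[OF pq(2), of p] by simp
    next
      case False
      then have "x \<notin> P i" "x \<notin> Q i" for i using ae_partitionD(2)[OF P, of i] ae_partitionD(2)[OF Q, of i] by auto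
      then show ?thesis by (simp add: s_def)
    qed
  qed
  have int_diff: "integrable lebesgue (\<lambda>x. s P x - s Q x)"
    using s_int P Q by simp
  have diff: "(LINT x|lebesgue. s P x - s Q x) =
      (\<Sum>i\<in>UNIV. LINT x:P i|lebesgue. h i x) - (\<Sum>i\<in>UNIV. LINT x:Q i|lebesgue. h i x)"
    by (simp add: s_eq P Q s_int)
  have nonneg: "AE x in lebesgue. 0 \<le> s P x - s Q x"
    using ae by eventually_elim blast
  show "(\<Sum>i\<in>UNIV. LINT x:Q i|lebesgue. h i x) \<le> (\<Sum>i\<in>UNIV. LINT x:P i|lebesgue. h i x)"
    using integral_nonneg_AE[OF nonneg] diff by simp
  assume "(\<Sum>i\<in>UNIV. LINT x:Q i|lebesgue. h i x) = (\<Sum>i\<in>UNIV. LINT x:P i|lebesgue. h i x)"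
  then have "AE x in lebesgue. s P x - s Q x = 0"
    using integral_nonneg_eq_0_iff_AE[OF int_diff nonneg] diff by simp
  with ae show "AE x in lebesgue. x \<in> P i \<longrightarrow> (\<forall>j. h i x \<le> h j x)"
    by eventually_elim blast
qed

text \<open>The indices are ordered by an injection into the naturals, and each contested point goes
  to the first set containing it. The result is truly disjoint, as \<open>volume_partitions\<close>
  demands.\<close>

lemma ae_partition_disjointify:
  fixes Q :: "'n::finite \<Rightarrow> 'a::euclidean_space set"
  assumes Q: "ae_partition \<Omega> Q"
  obtains P where "disjoint_family P" "(\<Union>i. P i) = \<Omega>" "\<And>i. P i \<in> sets lebesgue"
    "\<And>i. P i \<subseteq> Q i" "\<And>i. negligible (Q i - P i)"
proof -
  obtain f :: "'n \<Rightarrow> nat" where f: "inj f"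
    using finite_imp_inj_to_nat_seg[OF finite[of UNIV]] by metis
  define P where "P i = Q i - (\<Union>j\<in>{j. f j < f i}. Q j)" for i
  show thesis
  proof
    show "disjoint_family P"
      unfolding disjoint_family_on_def
    proof (intro ballI impI)
      fix i j :: 'n assume "i \<noteq> j"
      then have "f i < f j \<or> f j < f i" using f by (metis injD nat_neq_iff)
      then show "P i \<inter> P j = {}" by (auto simp: P_def)
    qed
    show "P i \<in> sets lebesgue" for i
      unfolding P_def using ae_partitionD(1)[OF Q] by (intro sets.Diff sets.finite_UN) auto
    show "P i \<subseteq> Q i" for i by (auto simp: P_def)
    have "Q i - P i = (\<Union>j\<in>{j. f j < f i}. Q i \<inter> Q j)" for i
      by (auto simp: P_def)
    moreover have "negligible (\<Union>j\<in>{j. f j < f i}. Q i \<inter> Q j)" for i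
      by (intro negligible_Union) (auto intro!: ae_partitionD(3)[OF Q])
    ultimately show "negligible (Q i - P i)" for i
      by simp
    show "(\<Union>i. P i) = \<Omega>"
    proof
      show "(\<Union>i. P i) \<subseteq> \<Omega>" using ae_partitionD(2)[OF Q] by (auto simp: P_def)
      show "\<Omega> \<subseteq> (\<Union>i. P i)"
      proof
        fix x assume "x \<in> \<Omega>"
        then obtain k where "x \<in> Q k" using Q by (auto simp: ae_partition_def)
        from exists_least_iff[of "\<lambda>m. \<exists>i. x \<in> Q i \<and> f i = m"] this
        obtain i where "x \<in> Q i" "\<And>j. f j < f i \<Longrightarrow> x \<notin> Q j" by blast
        then show "x \<in> (\<Union>i. P i)" by (auto simp: P_def)
      qed
    qed
  qed
qed

section \<open>Laguerre cells\<close>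

lemma set_integrable_compact_continuous:
  fixes f :: "'a::euclidean_space \<Rightarrow> 'b::euclidean_space"
  assumes "compact S" "continuous_on S f"
  shows "set_integrable lebesgue S f"
proof -
  have "integrable lborel (\<lambda>x. indicator S x *\<^sub>R f x)"
    by (rule borel_integrable_compact[OF assms])
  then show ?thesis
    unfolding set_integrable_def by (simp add: integrable_completion borel_measurable_integrable)
qed

locale laguerre =
  fixes \<Omega> :: "(real^'d) set" and A :: "real^'d^'d^'n"
  assumes compact: "compact \<Omega>" and spd: "\<And>i. sym_pos_def (A $ i)"
begin

abbreviation cost :: "real^'d^'n \<Rightarrow> 'n \<Rightarrow> real^'d \<Rightarrow> real" where
  "cost X i x \<equiv> (anorm (A $ i) (x - X $ i))\<^sup>2"

abbreviation cell :: "real^'d^'n \<Rightarrow> real^'n \<Rightarrow> 'n \<Rightarrow> (real^'d) set" where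
  "cell \<equiv> laguerre_cell \<Omega> A"

lemma set_integrable_continuous:
  "continuous_on UNIV f \<Longrightarrow> set_integrable lebesgue \<Omega> f" for f :: "real^'d \<Rightarrow> 'b::euclidean_space"
  using compact continuous_on_subset set_integrable_compact_continuous by blast

lemma cost_integrable: "set_integrable lebesgue \<Omega> (cost X i)"
  by (intro set_integrable_continuous continuous_intros spd)

lemma const_integrable: "set_integrable lebesgue \<Omega> (\<lambda>x. c :: real)"
  by (intro set_integrable_continuous continuous_intros)

lemma tendsto_cost:
  assumes "X \<longlonglongrightarrow> X0" "w \<longlonglongrightarrow> w0"
  shows "(\<lambda>k. cost (X k) i x - w k $ i) \<longlonglongrightarrow> cost X0 i x - w0 $ i"
proof -
  have "continuous_on UNIV (\<lambda>y. (anorm (A $ i) y)\<^sup>2)"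
    by (intro continuous_intros spd)
  then have "isCont (\<lambda>y. (anorm (A $ i) y)\<^sup>2) (x - X0 $ i)"
    by (simp add: continuous_on_eq_continuous_at)
  moreover have "(\<lambda>k. x - X k $ i) \<longlonglongrightarrow> x - X0 $ i"
    by (intro tendsto_intros assms)
  ultimately have "(\<lambda>k. cost (X k) i x) \<longlonglongrightarrow> cost X0 i x"
    by (rule isCont_tendsto_compose)
  then show ?thesis
    by (intro tendsto_diff tendsto_vec_nth assms)
qed

lemma closed_cell: "closed (cell X w i)"
proof -
  have "cell X w i = \<Omega> \<inter> (\<Inter>j. {x. cost X i x - w $ i \<le> cost X j x - w $ j})"
    by (auto simp: laguerre_cell_def)
  then show ?thesis
    by (simp only:) (intro closed_Int closed_INT ballI closed_Collect_le continuous_intros spd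
        compact_imp_closed compact)
qed

lemma cell_measurable: "cell X w i \<in> sets lebesgue"
  using closed_cell by (simp add: borel_closed)

lemma cell_subset: "cell X w i \<subseteq> \<Omega>"
  by (auto simp: laguerre_cell_def)

lemma negligible_ties:
  "X \<in> distinct_seeds \<Longrightarrow> i \<noteq> j \<Longrightarrow> negligible {x. cost X i x - w $ i = cost X j x - w $ j}"
  by (intro negligible_anorm_ties spd) (simp add: distinct_seeds_def)

lemma ae_partition_cells:
  assumes "X \<in> distinct_seeds"
  shows "ae_partition \<Omega> (cell X w)"
  unfolding ae_partition_def
proof (intro conjI allI impI)
  show "(\<Union>i. cell X w i) = \<Omega>"
  proof
    show "\<Omega> \<subseteq> (\<Union>i. cell X w i)"
    proof
      fix x assume "x \<in> \<Omega>"
      define f where "f i = cost X i x - w $ i" for i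
      have "Min (range f) \<in> range f"
        by (rule Min_in) auto
      then obtain i where i: "Min (range f) = f i" ..
      have "f i \<le> f j" for j
        unfolding i[symmetric] by simp
      with \<open>x \<in> \<Omega>\<close> show "x \<in> (\<Union>i. cell X w i)"
        by (auto simp: laguerre_cell_def f_def)
    qed
  qed (intro UN_least cell_subset)
  show "negligible (cell X w i \<inter> cell X w j)" if "i \<noteq> j" for i j
    by (rule negligible_subset[OF negligible_ties[OF assms that, of w]])
      (simp add: laguerre_cell_def subset_iff order_antisym)
qed (rule cell_measurable)

text \<open>Dominated convergence with \<open>f\<close> on \<Omega> as the bound. Off the ties of
  the limit configuration, membership of a point of \<Omega> is decided by strict inequalities,
  which persist along the sequence, so the indicators are eventually constant.\<close>

lemma cell_integral_tendsto:
  fixes f :: "real^'d \<Rightarrow> 'b::euclidean_space"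
  assumes f: "set_integrable lebesgue \<Omega> f"
    and X: "X \<longlonglongrightarrow> X0" and w: "w \<longlonglongrightarrow> w0" and X0: "X0 \<in> distinct_seeds"
  shows "(\<lambda>k. LINT x:cell (X k) (w k) i|lebesgue. f x) \<longlonglongrightarrow> (LINT x:cell X0 w0 i|lebesgue. f x)"
  unfolding set_lebesgue_integral_def
proof (rule integral_dominated_convergence)
  have int: "integrable lebesgue (\<lambda>x. indicator (cell X w i) x *\<^sub>R f x)" for X w
    using set_integrable_subset[OF f cell_measurable cell_subset] by (simp add: set_integrable_def)
  show "(\<lambda>x. indicator (cell X0 w0 i) x *\<^sub>R f x) \<in> borel_measurable lebesgue"
    and "(\<lambda>x. indicator (cell (X k) (w k) i) x *\<^sub>R f x) \<in> borel_measurable lebesgue" for k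
    using int by (simp_all add: borel_measurable_integrable)
  show "integrable lebesgue (\<lambda>x. norm (indicator \<Omega> x *\<^sub>R f x))"
    using f unfolding set_integrable_def by (rule integrable_norm)
  show "AE x in lebesgue. norm (indicator (cell (X k) (w k) i) x *\<^sub>R f x) \<le> norm (indicator \<Omega> x *\<^sub>R f x)" for k
    using cell_subset[of "X k" "w k" i] by (intro AE_I2) (auto simp: indicator_def)
  \<comment> \<open>The points where index \<open>i\<close> ties with another index in the
    limit.\<close>
  define N where "N = (\<Union>j\<in>-{i}. {x. cost X0 i x - w0 $ i = cost X0 j x - w0 $ j})"
  have "negligible N"
    unfolding N_def by (intro negligible_Union) (auto intro!: negligible_ties[OF X0])
  then have "AE x in lebesgue. x \<notin> N"
    by (simp add: negligible_iff_null_sets AE_not_in)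
  then show "AE x in lebesgue. (\<lambda>k. indicator (cell (X k) (w k) i) x *\<^sub>R f x)
      \<longlonglongrightarrow> indicator (cell X0 w0 i) x *\<^sub>R f x"
  proof eventually_elim
    case (elim x)
    note lim = tendsto_cost[OF X w, of _ x]
    have "\<forall>\<^sub>F k in sequentially. x \<in> cell (X k) (w k) i \<longleftrightarrow> x \<in> cell X0 w0 i"
    proof (cases "x \<in> cell X0 w0 i")
      case True
      have "\<forall>\<^sub>F k in sequentially. cost (X k) i x - w k $ i \<le> cost (X k) j x - w k $ j" for j
      proof (cases "j = i")
        case False
        with elim True have "cost X0 i x - w0 $ i < cost X0 j x - w0 $ j"
          by (force simp: N_def laguerre_cell_def less_le)
        from order_tendstoD(2)[OF tendsto_diff[OF lim[of i] lim[of j]], of 0] this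
        have "\<forall>\<^sub>F k in sequentially. (cost (X k) i x - w k $ i) - (cost (X k) j x - w k $ j) < 0"
          by simp
        then show ?thesis by eventually_elim simp
      qed simp
      then have "\<forall>\<^sub>F k in sequentially. \<forall>j. cost (X k) i x - w k $ i \<le> cost (X k) j x - w k $ j"
        by (rule eventually_all_finite)
      then show ?thesis
      proof eventually_elim
        case (elim k)
        with True show ?case by (auto simp: laguerre_cell_def)
      qed
    next
      case False
      show ?thesis
      proof (cases "x \<in> \<Omega>")
        case True
        with False obtain j where "cost X0 j x - w0 $ j < cost X0 i x - w0 $ i"
          by (auto simp: laguerre_cell_def not_le)
        from order_tendstoD(2)[OF tendsto_diff[OF lim[of j] lim[of i]], of 0] this
        have "\<forall>\<^sub>F k in sequentially. (cost (X k) j x - w k $ j) - (cost (X k) i x - w k $ i) < 0"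
          by simp
        then show ?thesis
        proof eventually_elim
          case (elim k)
          then have "x \<notin> cell (X k) (w k) i" by (auto simp: laguerre_cell_def not_le intro!: exI[of _ j])
          with False show ?case by simp
        qed
      qed (simp add: laguerre_cell_def)
    qed
    then have "\<forall>\<^sub>F k in sequentially. indicator (cell (X k) (w k) i) x *\<^sub>R f x = indicator (cell X0 w0 i) x *\<^sub>R f x"
      by eventually_elim (simp add: indicator_def)
    then show ?case by (rule tendsto_eventually)
  qed
qed

section \<open>Optimality and uniqueness of the cells\<close>

text \<open>The weights change the total cost by an amount that depends on the volumes only, so they
  cancel between partitions of equal volumes.\<close>

lemma sum_shifted_cost:
  assumes "\<And>i. P i \<in> sets lebesgue" "\<And>i. P i \<subseteq> \<Omega>"
  shows "(\<Sum>i\<in>UNIV. LINT x:P i|lebesgue. cost X i x - w $ i) =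
    (\<Sum>i\<in>UNIV. LINT x:P i|lebesgue. cost X i x) - (\<Sum>i\<in>UNIV. w $ i * vol (P i))"
proof -
  have "(LINT x:P i|lebesgue. cost X i x - w $ i) = (LINT x:P i|lebesgue. cost X i x) - w $ i * vol (P i)" for i
  proof -
    have "set_integrable lebesgue (P i) (cost X i)" "set_integrable lebesgue (P i) (\<lambda>x. w $ i)"
      by (intro set_integrable_subset[OF cost_integrable] set_integrable_subset[OF const_integrable] assms)+
    then have "(LINT x:P i|lebesgue. cost X i x - w $ i) =
        (LINT x:P i|lebesgue. cost X i x) - (LINT x:P i|lebesgue. w $ i)"
      by (rule set_integral_diff)
    then show ?thesis by (simp add: set_lebesgue_integral_def mult.commute)
  qed
  then show ?thesis by (simp add: sum_subtractf)
qed

lemma shifted_cost_integrable: "set_integrable lebesgue \<Omega> (\<lambda>x. cost X i x - w $ i)"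
  by (intro set_integrable_continuous continuous_intros spd)

lemma shifted_cost_cells_le:
  assumes "X \<in> distinct_seeds" "ae_partition \<Omega> P"
  shows "(\<Sum>i\<in>UNIV. LINT x:cell X w i|lebesgue. cost X i x - w $ i)
      \<le> (\<Sum>i\<in>UNIV. LINT x:P i|lebesgue. cost X i x - w $ i)"
  by (rule ae_partition_integral_le[OF assms(2) ae_partition_cells[OF assms(1)] shifted_cost_integrable])
    (simp add: laguerre_cell_def)

text \<open>The weights act as Lagrange multipliers: the cells minimise the shifted cost among all
  partitions, and for equal volumes the shifts cancel.\<close>

lemma cells_optimal:
  assumes X: "X \<in> distinct_seeds" and P: "ae_partition \<Omega> P"
    and vol: "\<And>i. vol (cell X w i) = vol (P i)"
  shows "(\<Sum>i\<in>UNIV. LINT x:cell X w i|lebesgue. cost X i x) \<le> (\<Sum>i\<in>UNIV. LINT x:P i|lebesgue. cost X i x)"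
  using shifted_cost_cells_le[OF X P, of w] ae_partitionD(1,2)[OF P]
  by (simp add: sum_shifted_cost cell_measurable cell_subset vol)

text \<open>By optimality in both directions the two families have the same cost, hence the same
  cost shifted by \<open>w\<close>. The equality case of the comparison then says that almost every
  point of a cell for \<open>w'\<close> minimises the costs shifted by \<open>w\<close>.\<close>

lemma cells_unique:
  assumes X: "X \<in> distinct_seeds" and vol: "\<And>i. vol (cell X w i) = vol (cell X w' i)"
  shows "AE x in lebesgue. x \<in> cell X w i \<longleftrightarrow> x \<in> cell X w' i"
proof -
  have sub: "AE x in lebesgue. x \<in> cell X w' i \<longrightarrow> x \<in> cell X w i"
    if vol: "\<And>i. vol (cell X w i) = vol (cell X w' i)" for w w'
  proof -
    have "(\<Sum>i\<in>UNIV. LINT x:cell X w i|lebesgue. cost X i x) = (\<Sum>i\<in>UNIV. LINT x:cell X w' i|lebesgue. cost X i x)"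
      using cells_optimal[OF X ae_partition_cells[OF X]] vol by (intro antisym) simp_all
    then have eq: "(\<Sum>i\<in>UNIV. LINT x:cell X w i|lebesgue. cost X i x - w $ i) =
        (\<Sum>i\<in>UNIV. LINT x:cell X w' i|lebesgue. cost X i x - w $ i)"
      by (simp add: sum_shifted_cost cell_measurable cell_subset vol)
    have "AE x in lebesgue. x \<in> cell X w' i \<longrightarrow> (\<forall>j. cost X i x - w $ i \<le> cost X j x - w $ j)"
      by (rule ae_partition_integral_eqD[OF ae_partition_cells[OF X] ae_partition_cells[OF X, of w]
          shifted_cost_integrable _ eq]) (simp add: laguerre_cell_def)
    then show ?thesis
      by eventually_elim (auto simp: laguerre_cell_def)
  qed
  from sub[OF vol] sub[OF vol[symmetric]] show ?thesis
    by eventually_elim blast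
qed

lemma cell_integral_unique:
  fixes f :: "real^'d \<Rightarrow> 'b::euclidean_space"
  assumes "X \<in> distinct_seeds" "\<And>i. vol (cell X w i) = vol (cell X w' i)" "set_integrable lebesgue \<Omega> f"
  shows "(LINT x:cell X w i|lebesgue. f x) = (LINT x:cell X w' i|lebesgue. f x)"
  using set_integral_cong_set_AE[OF assms(3) cell_measurable cell_subset cell_measurable cell_subset
      cells_unique[OF assms(1,2)]] .

lemma cell_shift: "cell X (\<chi> i. w $ i + c) = cell X w"
  by (simp add: laguerre_cell_def fun_eq_iff algebra_simps)

lemma ae_partition_single: "ae_partition \<Omega> (\<lambda>i. if i = k then \<Omega> else {})" for k :: 'n
  using compact by (auto simp: ae_partition_def borel_compact)

text \<open>For the constant cost 1 every partition is minimal, so the comparison with the partition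
  that gives all of \<Omega> to one index holds in both directions.\<close>

lemma sum_vol_cells:
  assumes X: "X \<in> distinct_seeds"
  shows "(\<Sum>i\<in>UNIV. vol (cell X w i)) = vol \<Omega>"
proof -
  fix k :: 'n
  let ?S = "\<lambda>i. if i = k then \<Omega> else {}"
  have "(\<Sum>i\<in>UNIV. vol (cell X w i)) = (\<Sum>i\<in>UNIV. vol (?S i))"
    unfolding vol_eq_set_integral
    by (intro antisym ae_partition_integral_le[where \<Omega> = \<Omega>] ae_partition_cells[OF X]
        ae_partition_single const_integrable) simp_all
  also have "\<dots> = (\<Sum>i\<in>UNIV. if i = k then vol \<Omega> else 0)"
    by (intro sum.cong) auto
  finally show ?thesis by simp
qed

lemma vol_cell_tendsto:
  assumes "X \<longlonglongrightarrow> X0" "w \<longlonglongrightarrow> w0" "X0 \<in> distinct_seeds"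
  shows "(\<lambda>k. vol (cell (X k) (w k) i)) \<longlonglongrightarrow> vol (cell X0 w0 i)"
  unfolding vol_eq_set_integral by (rule cell_integral_tendsto[OF const_integrable assms])

end

section \<open>Existence of weights by maximising the dual functional\<close>

locale laguerre_volumes = laguerre \<Omega> A for \<Omega> :: "(real^'d) set" and A :: "real^'d^'d^'n" +
  fixes v :: "real^'n"
  assumes v_pos: "\<And>i. 0 < v $ i" and v_sum: "(\<Sum>i\<in>UNIV. v $ i) = vol \<Omega>"
begin

text \<open>The Kantorovich dual functional: its maximisers are the weights with cell volumes \<open>v\<close>.\<close>

definition dual :: "real^'d^'n \<Rightarrow> real^'n \<Rightarrow> real" where
  "dual X w = (\<Sum>i\<in>UNIV. LINT x:cell X w i|lebesgue. cost X i x - w $ i) + (\<Sum>i\<in>UNIV. v $ i * w $ i)"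

text \<open>Weak duality, with a correction for volumes that differ from \<open>v\<close>.\<close>

lemma dual_le:
  assumes "X \<in> distinct_seeds" "ae_partition \<Omega> P"
  shows "dual X w \<le> (\<Sum>i\<in>UNIV. LINT x:P i|lebesgue. cost X i x) + (\<Sum>i\<in>UNIV. (v $ i - vol (P i)) * w $ i)"
  using shifted_cost_cells_le[OF assms, of w] ae_partitionD(1,2)[OF assms(2)]
  by (simp add: dual_def sum_shifted_cost algebra_simps sum_subtractf)

lemma dual_eq:
  "dual X w = (\<Sum>i\<in>UNIV. LINT x:cell X w i|lebesgue. cost X i x) + (\<Sum>i\<in>UNIV. (v $ i - vol (cell X w i)) * w $ i)"
  by (simp add: dual_def sum_shifted_cost cell_measurable cell_subset algebra_simps sum_subtractf)

text \<open>The cells for \<open>w\<close> compete at \<open>w'\<close>; the resulting bound is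
  affine in \<open>w'\<close> and exact at \<open>w\<close>.\<close>

lemma dual_supergradient:
  assumes X: "X \<in> distinct_seeds"
  shows "dual X w' \<le> dual X w + (\<Sum>i\<in>UNIV. (v $ i - vol (cell X w i)) * (w' $ i - w $ i))"
  using dual_le[OF X ae_partition_cells[OF X], of w' w]
  by (simp add: dual_eq[of X w] right_diff_distrib sum_subtractf)

lemma dual_shift:
  assumes X: "X \<in> distinct_seeds"
  shows "dual X (\<chi> i. w $ i + c) = dual X w"
proof -
  have "(\<Sum>i\<in>UNIV. (v $ i - vol (cell X w i)) * (w $ i + c)) =
      (\<Sum>i\<in>UNIV. (v $ i - vol (cell X w i)) * w $ i) + (\<Sum>i\<in>UNIV. v $ i - vol (cell X w i)) * c"
    by (simp add: distrib_left sum.distrib sum_distrib_right)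
  also have "(\<Sum>i\<in>UNIV. v $ i - vol (cell X w i)) = 0"
    by (simp add: sum_subtractf v_sum sum_vol_cells[OF X])
  finally show ?thesis
    by (simp add: dual_eq cell_shift)
qed

text \<open>Coercivity up to constants, from the partition that gives everything to
  \<open>j\<close>: when \<open>w $ j\<close> is the largest weight, all summands on the right are
  nonnegative and a large spread pushes the dual functional down.\<close>

lemma dual_le_spread:
  assumes X: "X \<in> distinct_seeds"
  shows "dual X w \<le> (LINT x:\<Omega>|lebesgue. cost X j x) - (\<Sum>i\<in>UNIV. v $ i * (w $ j - w $ i))"
proof -
  let ?S = "\<lambda>i. if i = j then \<Omega> else {}"
  have "(\<Sum>i\<in>UNIV. LINT x:?S i|lebesgue. cost X i x) =
      (\<Sum>i\<in>UNIV. if i = j then LINT x:\<Omega>|lebesgue. cost X j x else 0)"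
    by (intro sum.cong) (auto simp: set_lebesgue_integral_def)
  moreover have "(\<Sum>i\<in>UNIV. (v $ i - vol (?S i)) * w $ i) =
      (\<Sum>i\<in>UNIV. v $ i * w $ i - (if i = j then vol \<Omega> * w $ j else 0))"
    by (intro sum.cong) (auto simp: algebra_simps)
  moreover have "(\<Sum>i\<in>UNIV. v $ i * (w $ j - w $ i)) = vol \<Omega> * w $ j - (\<Sum>i\<in>UNIV. v $ i * w $ i)"
    by (simp add: right_diff_distrib sum_subtractf flip: sum_distrib_right v_sum)
  ultimately show ?thesis
    using dual_le[OF X ae_partition_single[of j], of w] by (simp add: sum_subtractf)
qed

lemma continuous_dual:
  assumes X: "X \<in> distinct_seeds"
  shows "continuous_on S (dual X)"
  unfolding continuous_on_sequentially comp_def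
proof (intro allI ballI impI, elim conjE)
  fix w :: "nat \<Rightarrow> real^'n" and w0 assume w: "w \<longlonglongrightarrow> w0"
  show "(\<lambda>k. dual X (w k)) \<longlonglongrightarrow> dual X w0"
    unfolding dual_eq
    by (intro tendsto_intros cell_integral_tendsto cost_integrable vol_cell_tendsto X w)
qed

text \<open>Shift invariance lets the largest weight be 0. Then either the weights lie in the
  compact box \<open>?K\<close>, or their spread is so large that the value is at most the one at 0,
  a point of the box.\<close>

lemma dual_attains_max:
  assumes X: "X \<in> distinct_seeds"
  obtains w where "\<And>w'. dual X w' \<le> dual X w"
proof -
  \<comment> \<open>\<open>C\<close> bounds the cost of giving \<Omega> to any one seed. A weight
    more than \<open>R\<close> below the largest one lowers the bound by at least \<open>D\<close>,
    hence to \<open>dual X 0\<close> or less; the absolute value in \<open>D\<close> keeps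
    \<open>R\<close> nonnegative.\<close>
  define C where "C = (\<Sum>j\<in>UNIV. LINT x:\<Omega>|lebesgue. cost X j x)"
  define D where "D = \<bar>C - dual X 0\<bar>"
  define R where "R = (\<Sum>i\<in>UNIV. D / v $ i)"
  have R_i: "D / v $ i \<le> R" for i
    unfolding R_def using v_pos by (intro member_le_sum) (auto simp: D_def less_imp_le)
  have "0 \<le> R"
    unfolding R_def using v_pos by (intro sum_nonneg) (auto simp: D_def less_imp_le)
  let ?K = "cbox (\<chi> i. - R) 0 :: (real^'n) set"
  have mem: "w \<in> ?K \<longleftrightarrow> (\<forall>i. - R \<le> w $ i \<and> w $ i \<le> 0)" for w
    by (simp add: mem_box_cart)
  have "0 \<in> ?K" using \<open>0 \<le> R\<close> by (simp add: mem)
  then have "?K \<noteq> {}" by blast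
  then obtain w where w: "w \<in> ?K" "\<And>w'. w' \<in> ?K \<Longrightarrow> dual X w' \<le> dual X w"
    using continuous_attains_sup[OF compact_cbox _ continuous_dual[OF X]] by blast
  have "dual X w' \<le> dual X w" for w'
  proof -
    have "Max (range (($) w')) \<in> range (($) w')"
      by (rule Max_in) auto
    then obtain j where j: "Max (range (($) w')) = w' $ j" by blast
    have max: "w' $ i \<le> w' $ j" for i
      unfolding j[symmetric] by simp
    define u where "u = (\<chi> i. w' $ i + - (w' $ j))"
    show ?thesis
    proof (cases "u \<in> ?K")
      case True
      then have "dual X u \<le> dual X w" by (rule w(2))
      then show ?thesis unfolding u_def dual_shift[OF X] .
    next
      case False
      then obtain i where "w' $ i - w' $ j < - R"
        using max by (auto simp: mem u_def not_le)
      with R_i[of i] have "D / v $ i \<le> w' $ j - w' $ i" by simp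
      then have "D \<le> v $ i * (w' $ j - w' $ i)"
        using v_pos[of i] by (simp add: divide_le_eq mult.commute)
      also have "\<dots> \<le> (\<Sum>i\<in>UNIV. v $ i * (w' $ j - w' $ i))"
        using max v_pos by (intro member_le_sum) (auto simp: less_imp_le)
      finally have "D \<le> (\<Sum>i\<in>UNIV. v $ i * (w' $ j - w' $ i))" .
      moreover have "(LINT x:\<Omega>|lebesgue. cost X j x) \<le> C"
        unfolding C_def set_lebesgue_integral_def by (intro member_le_sum integral_nonneg_AE) auto
      moreover have "C - dual X 0 \<le> D" by (simp add: D_def)
      ultimately have "dual X w' \<le> dual X 0"
        using dual_le_spread[OF X, of w' j] by linarith
      also have "\<dots> \<le> dual X w" using w(2) \<open>0 \<in> ?K\<close> .
      finally show ?thesis .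
    qed
  qed
  then show thesis by (rule that)
qed

text \<open>At a maximiser the volume defects should vanish. Instead of differentiating the dual
  functional, the supergradient is taken at points slightly moved from the maximiser, and continuity
  of the volumes gives the limit.\<close>

lemma ex_weights:
  assumes X: "X \<in> distinct_seeds"
  shows "\<exists>w. \<forall>i. vol (cell X w i) = v $ i"
proof -
  obtain w where max: "\<And>w'. dual X w' \<le> dual X w"
    using dual_attains_max[OF X] by blast
  \<comment> \<open>The defect is itself the test direction, so the limit inequality bounds its
    squared norm by 0.\<close>
  define u where "u = (\<chi> i. v $ i - vol (cell X w i))"
  define t :: "nat \<Rightarrow> real" where "t k = inverse (real (Suc k))" for k
  have t: "t \<longlonglongrightarrow> 0" "t k > 0" for k
    unfolding t_def using LIMSEQ_inverse_real_of_nat by (simp_all add: t_def)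
  have "(\<lambda>k. w + t k *\<^sub>R u) \<longlonglongrightarrow> w + 0 *\<^sub>R u"
    by (intro tendsto_intros t)
  then have lim: "(\<lambda>k. w + t k *\<^sub>R u) \<longlonglongrightarrow> w" by simp
  have "(\<lambda>k. \<Sum>i\<in>UNIV. (v $ i - vol (cell X (w + t k *\<^sub>R u) i)) * u $ i) \<longlonglongrightarrow>
      (\<Sum>i\<in>UNIV. (v $ i - vol (cell X w i)) * u $ i)"
    by (intro tendsto_intros vol_cell_tendsto X lim)
  moreover have "(\<Sum>i\<in>UNIV. (v $ i - vol (cell X (w + t k *\<^sub>R u) i)) * u $ i) \<le> 0" for k
  proof -
    have "dual X w \<le> dual X (w + t k *\<^sub>R u) +
        (\<Sum>i\<in>UNIV. (v $ i - vol (cell X (w + t k *\<^sub>R u) i)) * (w $ i - (w + t k *\<^sub>R u) $ i))"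
      by (rule dual_supergradient[OF X])
    also have "\<dots> \<le> dual X w +
        (\<Sum>i\<in>UNIV. (v $ i - vol (cell X (w + t k *\<^sub>R u) i)) * (w $ i - (w + t k *\<^sub>R u) $ i))"
      using max by simp
    also have "(\<Sum>i\<in>UNIV. (v $ i - vol (cell X (w + t k *\<^sub>R u) i)) * (w $ i - (w + t k *\<^sub>R u) $ i)) =
        - (t k * (\<Sum>i\<in>UNIV. (v $ i - vol (cell X (w + t k *\<^sub>R u) i)) * u $ i))"
      unfolding sum_distrib_left sum_negf[symmetric] by (intro sum.cong) (auto simp: algebra_simps)
    finally show ?thesis using t(2)[of k] by (simp add: mult_le_0_iff)
  qed
  ultimately have "(\<Sum>i\<in>UNIV. (v $ i - vol (cell X w i)) * u $ i) \<le> 0"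
    by (intro LIMSEQ_le_const2) auto
  then have "(\<Sum>i\<in>UNIV. (u $ i)\<^sup>2) = 0"
    by (intro antisym sum_nonneg) (simp_all add: u_def power2_eq_square)
  then have "\<forall>i. u $ i = 0"
    by (simp add: sum_nonneg_eq_0_iff)
  then show ?thesis by (auto simp: u_def)
qed

section \<open>Optimal cells and their dependence on the seeds\<close>

lemma vol_optimal_cell:
  assumes "X \<in> distinct_seeds"
  shows "vol (optimal_cell \<Omega> A X v i) = v $ i"
  unfolding optimal_cell_def optimal_weights_def using someI_ex[OF ex_weights[OF assms]] by blast

text \<open>Makes the choice inside \<open>optimal_weights\<close> harmless, by uniqueness of the
  cells up to null sets.\<close>

lemma optimal_cell_integral_eq:
  fixes f :: "real^'d \<Rightarrow> 'b::euclidean_space"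
  assumes "X \<in> distinct_seeds" "\<And>i. vol (cell X w i) = v $ i" "set_integrable lebesgue \<Omega> f"
  shows "(LINT x:optimal_cell \<Omega> A X v i|lebesgue. f x) = (LINT x:cell X w i|lebesgue. f x)"
  using assms vol_optimal_cell[OF assms(1)] unfolding optimal_cell_def
  by (intro cell_integral_unique) auto

text \<open>A cell of positive volume contains a point; there the defining inequality against
  \<open>j\<close>, with the nonnegative cost of \<open>i\<close> dropped, bounds the
  difference.\<close>

lemma weight_difference_le:
  assumes vol: "vol (cell X w i) = v $ i" and M: "\<And>x. x \<in> \<Omega> \<Longrightarrow> cost X j x \<le> M"
  shows "w $ j - w $ i \<le> M"
proof -
  have "cell X w i \<noteq> {}" using vol v_pos[of i] by auto
  then obtain x where "x \<in> cell X w i" by blast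
  then have "x \<in> \<Omega>" "cost X i x - w $ i \<le> cost X j x - w $ j"
    by (auto simp: laguerre_cell_def)
  with M[of x] zero_le_power2[of "anorm (A $ i) (x - X $ i)"] show ?thesis by linarith
qed

lemma bounded_costs:
  assumes "bounded S"
  obtains M where "\<And>X x. X \<in> S \<Longrightarrow> x \<in> \<Omega> \<Longrightarrow> cost X i x \<le> M"
proof -
  have "compact ((\<lambda>p. cost (fst p) i (snd p)) ` (closure S \<times> \<Omega>))"
    by (intro compact_continuous_image continuous_intros spd compact_Times compact)
      (use assms in \<open>simp add: compact_closure\<close>)
  then have "bdd_above ((\<lambda>p. cost (fst p) i (snd p)) ` (closure S \<times> \<Omega>))"
    by (intro bounded_imp_bdd_above compact_imp_bounded)
  then obtain M where M: "\<forall>p\<in>closure S \<times> \<Omega>. cost (fst p) i (snd p) \<le> M"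
    by (auto simp: bdd_above_def)
  show thesis
  proof
    show "cost X i x \<le> M" if "X \<in> S" "x \<in> \<Omega>" for X x
      using M[rule_format, of "(X, x)"] that closure_subset by auto
  qed
qed

text \<open>
  The optimal weights, normalised by subtracting one fixed component, stay bounded along a convergent
  sequence of seeds, and every limit point of them has the prescribed volumes.
\<close>

lemma continuous_optimal_cell_integral:
  fixes f :: "real^'d \<Rightarrow> 'b::euclidean_space"
  assumes f: "set_integrable lebesgue \<Omega> f"
  shows "continuous_on distinct_seeds (\<lambda>X. LINT x:optimal_cell \<Omega> A X v i|lebesgue. f x)"
    (is "continuous_on _ ?F")
  unfolding continuous_on_sequentially comp_def
proof (intro allI ballI impI, elim conjE, rule ccontr)
  fix X X0 assume X0: "X0 \<in> distinct_seeds" and X: "\<forall>k. X k \<in> distinct_seeds" "X \<longlonglongrightarrow> X0"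
    and "\<not> (\<lambda>k. ?F (X k)) \<longlonglongrightarrow> ?F X0"
  \<comment> \<open>If convergence fails, the integrals stay at distance at least \<open>e\<close>
    from \<open>?F X0\<close> along a subsequence; a further subsequence with convergent weights
    will contradict this.\<close>
  then obtain e where "e > 0" and e: "\<not> (\<forall>\<^sub>F k in sequentially. dist (?F (X k)) (?F X0) < e)"
    by (auto simp: tendsto_iff)
  from not_eventually_sequentiallyD[OF e]
  obtain r :: "nat \<Rightarrow> nat" where r: "strict_mono r" "\<And>k. \<not> dist (?F (X (r k))) (?F X0) < e"
    by auto
  define Y where "Y k = X (r k)" for k
  have Y: "Y k \<in> distinct_seeds" "Y \<longlonglongrightarrow> X0" for k
    using X LIMSEQ_subseq_LIMSEQ[OF X(2) r(1)] unfolding Y_def[abs_def] comp_def by auto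
  obtain M where M: "\<And>i k x. x \<in> \<Omega> \<Longrightarrow> cost (Y k) i x \<le> M i"
  proof -
    have "bounded (range Y)" using Y(2) by (rule convergent_imp_bounded)
    then have "\<exists>M. \<forall>X\<in>range Y. \<forall>x\<in>\<Omega>. cost X i x \<le> M" for i
      using bounded_costs[of "range Y" i] by metis
    then show thesis using that by (metis rangeI)
  qed
  fix j :: 'n
  define w where "w k = (\<chi> i. optimal_weights \<Omega> A (Y k) v $ i + - optimal_weights \<Omega> A (Y k) v $ j)" for k
  have vol: "vol (cell (Y k) (w k) i) = v $ i" for k i
    using vol_optimal_cell[OF Y(1)] unfolding w_def cell_shift optimal_cell_def .
  have "bounded (range w)"
  proof (rule boundedI)
    fix z assume "z \<in> range w"
    then obtain k where z: "z = w k" by blast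
    have "\<bar>w k $ i\<bar> \<le> \<bar>M i\<bar> + \<bar>M j\<bar>" for i
      using weight_difference_le[OF vol M, of k i j] weight_difference_le[OF vol M, of k j i]
      by (simp add: w_def)
    then show "norm z \<le> (\<Sum>i\<in>UNIV. \<bar>M i\<bar> + \<bar>M j\<bar>)"
      unfolding z by (intro order_trans[OF norm_le_l1_cart] sum_mono)
  qed
  then obtain w0 s where s: "strict_mono s" "(w \<circ> s) \<longlonglongrightarrow> w0"
    using bounded_imp_convergent_subsequence by blast
  have Ys: "(Y \<circ> s) \<longlonglongrightarrow> X0" by (rule LIMSEQ_subseq_LIMSEQ[OF Y(2) s(1)])
  have "vol (cell X0 w0 i) = v $ i" for i
    using LIMSEQ_unique[OF vol_cell_tendsto[OF Ys s(2) X0, of i]] vol by simp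
  then have "?F X0 = (LINT x:cell X0 w0 i|lebesgue. f x)"
    by (intro optimal_cell_integral_eq X0 f)
  moreover have "?F (Y k) = (LINT x:cell (Y k) (w k) i|lebesgue. f x)" for k
    by (intro optimal_cell_integral_eq Y f vol)
  ultimately have "(\<lambda>k. ?F (Y (s k))) \<longlonglongrightarrow> ?F X0"
    using cell_integral_tendsto[OF f Ys s(2) X0, of i] by simp
  then have "\<forall>\<^sub>F k in sequentially. dist (?F (Y (s k))) (?F X0) < e"
    using \<open>e > 0\<close> by (rule tendstoD)
  then obtain k where "dist (?F (Y (s k))) (?F X0) < e"
    by (meson eventually_happens trivial_limit_sequentially)
  with r(2) show False by (simp add: Y_def)
qed

lemma volume_partitionsD:
  assumes "P \<in> volume_partitions \<Omega> v"
  shows "P i \<in> sets lebesgue" "P i \<subseteq> \<Omega>" "vol (P i) = v $ i" "ae_partition \<Omega> P"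
  using assms by (auto simp: volume_partitions_def ae_partition_def disjoint_family_on_def)

text \<open>Assigning each tie to one cell changes the cells by null sets only. This gives an
  admissible competitor for the transport cost.\<close>

lemma ex_volume_partition:
  assumes X: "X \<in> distinct_seeds"
  obtains P where "P \<in> volume_partitions \<Omega> v"
    "\<And>i. AE x in lebesgue. x \<in> P i \<longleftrightarrow> x \<in> optimal_cell \<Omega> A X v i"
proof -
  define L where "L = optimal_cell \<Omega> A X v"
  have L: "ae_partition \<Omega> L"
    using ae_partition_cells[OF X] unfolding L_def optimal_cell_def[abs_def] .
  obtain P where P: "disjoint_family P" "(\<Union>i. P i) = \<Omega>" "\<And>i. P i \<in> sets lebesgue"
    "\<And>i. P i \<subseteq> L i" "\<And>i. negligible (L i - P i)"
    using ae_partition_disjointify[OF L] by blast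
  have ae: "AE x in lebesgue. x \<in> P i \<longleftrightarrow> x \<in> L i" for i
  proof -
    have "AE x in lebesgue. x \<notin> L i - P i"
      by (rule AE_not_in) (use P(5) in \<open>simp add: negligible_iff_null_sets\<close>)
    then show ?thesis
      by eventually_elim (use P(4) in blast)
  qed
  have "vol (P i) = vol (L i)" for i
    using P(2) unfolding vol_eq_set_integral
    by (intro set_integral_cong_set_AE[OF const_integrable] ae P(3) ae_partitionD(1,2)[OF L]) blast
  then have "P \<in> volume_partitions \<Omega> v"
    using P vol_optimal_cell[OF X] by (simp add: volume_partitions_def L_def)
  with ae show thesis unfolding L_def by (intro that)
qed

end

section \<open>The concave functional\<close>

locale laguerre_data = laguerre_volumes \<Omega> A v
  for \<Omega> :: "(real^'d) set" and A :: "real^'d^'d^'n" and v :: "real^'n" +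
  fixes B :: "real^'d^'n"
begin

text \<open>\<open>H_fun\<close> with the infimum replaced by the cost of one family of sets.
  Disjointness is not built in, so Laguerre cells can be inserted directly.\<close>

definition upper :: "('n \<Rightarrow> (real^'d) set) \<Rightarrow> real^'d^'n \<Rightarrow> real" where
  "upper P X = 1/2 * (\<Sum>i\<in>UNIV. LINT x:P i|lebesgue. cost X i x)
     - 1/2 * (\<Sum>i\<in>UNIV. v $ i * (anorm (A $ i) (X $ i))\<^sup>2)
     + (\<Sum>i\<in>UNIV. v $ i * (X $ i \<bullet> (A $ i *v B $ i)))"

text \<open>The gradient of \<open>upper P\<close> when \<open>P\<close> has volumes
  \<open>v\<close>, written with first moments rather than centroids.\<close>

definition slope :: "('n \<Rightarrow> (real^'d) set) \<Rightarrow> real^'d^'n" where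
  "slope P = (\<chi> i. A $ i *v (v $ i *\<^sub>R B $ i - (LINT x:P i|lebesgue. x)))"

lemma id_integrable: "set_integrable lebesgue \<Omega> (\<lambda>x. x)"
  by (intro set_integrable_continuous continuous_intros)

lemma integral_cost_expand:
  assumes P: "P \<in> sets lebesgue" "P \<subseteq> \<Omega>"
  shows "(LINT x:P|lebesgue. cost X i x) = (LINT x:P|lebesgue. (anorm (A $ i) x)\<^sup>2)
    - 2 * (X $ i \<bullet> (A $ i *v (LINT x:P|lebesgue. x))) + vol P * (anorm (A $ i) (X $ i))\<^sup>2"
proof -
  have sym: "transpose (A $ i) = A $ i" using spd by (simp add: sym_pos_def_def)
  have cost: "cost X i x = (anorm (A $ i) x)\<^sup>2 - x \<bullet> (2 *\<^sub>R (A $ i *v X $ i)) + (anorm (A $ i) (X $ i))\<^sup>2" for x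
    using symmetric_matrix_inner[OF sym, of x "X $ i"]
    by (simp add: anorm_power2[OF spd] matrix_vector_mult_diff_distrib inner_diff)
  have int: "set_integrable lebesgue P f" if "continuous_on UNIV f" for f :: "real^'d \<Rightarrow> 'e::euclidean_space"
    using set_integrable_subset[OF set_integrable_continuous[OF that] P] .
  have "(LINT x:P|lebesgue. cost X i x) = (LINT x:P|lebesgue. (anorm (A $ i) x)\<^sup>2)
      - (LINT x:P|lebesgue. x \<bullet> (2 *\<^sub>R (A $ i *v X $ i))) + (LINT x:P|lebesgue. (anorm (A $ i) (X $ i))\<^sup>2)"
  proof -
    have c: "continuous_on UNIV (\<lambda>x. (anorm (A $ i) x)\<^sup>2)"
      by (intro continuous_intros spd)
    have d: "continuous_on UNIV (\<lambda>x. x \<bullet> (2 *\<^sub>R (A $ i *v X $ i)))"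
      by (intro continuous_intros)
    have e: "continuous_on UNIV (\<lambda>x::real^'d. (anorm (A $ i) (X $ i))\<^sup>2)"
      by (rule continuous_on_const)
    show ?thesis
      unfolding cost set_integral_add(2)[OF set_integral_diff(1)[OF int[OF c] int[OF d]] int[OF e]]
        set_integral_diff(2)[OF int[OF c] int[OF d]] ..
  qed
  also have "(LINT x:P|lebesgue. x \<bullet> (2 *\<^sub>R (A $ i *v X $ i))) = (LINT x:P|lebesgue. x) \<bullet> (2 *\<^sub>R (A $ i *v X $ i))"
  proof -
    have "integrable lebesgue (\<lambda>x. indicator P x *\<^sub>R x)"
      using int[of "\<lambda>x. x"] by (simp add: set_integrable_def)
    from integral_inner_left[OF this, of "2 *\<^sub>R (A $ i *v X $ i)"] show ?thesis
      by (simp add: set_lebesgue_integral_def)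
  qed
  also have "\<dots> = 2 * (X $ i \<bullet> (A $ i *v (LINT x:P|lebesgue. x)))"
    using symmetric_matrix_inner[OF sym] by simp
  also have "(LINT x:P|lebesgue. (anorm (A $ i) (X $ i))\<^sup>2) = vol P * (anorm (A $ i) (X $ i))\<^sup>2"
    by (simp add: set_lebesgue_integral_def)
  finally show ?thesis .
qed

text \<open>Since \<open>vol (P i) = v $ i\<close>, the quadratic terms of the expanded cost cancel
  those subtracted in \<open>upper\<close>; the halved mixed terms combine with the terms in
  \<open>B\<close> to the slope.\<close>

lemma upper_affine:
  assumes P: "\<And>i. P i \<in> sets lebesgue" "\<And>i. P i \<subseteq> \<Omega>" "\<And>i. vol (P i) = v $ i"
  shows "upper P X = 1/2 * (\<Sum>i\<in>UNIV. LINT x:P i|lebesgue. (anorm (A $ i) x)\<^sup>2) + slope P \<bullet> X"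
  unfolding upper_def inner_vec_def[of "slope P" X] sum_distrib_left sum_subtractf[symmetric] sum.distrib[symmetric]
  by (intro sum.cong refl)
    (simp add: slope_def integral_cost_expand P matrix_vector_mult_diff_distrib matrix_vector_mult_scaleR
      inner_diff_right inner_commute field_simps)

lemma cost_sum_nonneg: "0 \<le> (\<Sum>i\<in>UNIV. LINT x:P i|lebesgue. cost X i x)"
  unfolding set_lebesgue_integral_def by (intro sum_nonneg integral_nonneg_AE) auto

lemma H_fun_le_upper:
  assumes "P \<in> volume_partitions \<Omega> v"
  shows "H_fun \<Omega> A v B X \<le> upper P X"
proof -
  have "transport_cost \<Omega> A X v \<le> (\<Sum>i\<in>UNIV. LINT x:P i|lebesgue. cost X i x)"
    unfolding transport_cost_def
    by (rule cINF_lower[OF _ assms]) (auto intro!: bdd_belowI2[of _ 0] cost_sum_nonneg)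
  then show ?thesis by (simp add: H_fun_def upper_def)
qed

text \<open>With \<open>H_fun_le_upper\<close> this makes \<open>H_fun\<close> the infimum of the
  functions \<open>upper P\<close>. A real infimum needs a nonempty index set, which comes from the
  cells of arbitrary distinct seeds.\<close>

lemma H_fun_greatest:
  assumes "\<And>P. P \<in> volume_partitions \<Omega> v \<Longrightarrow> z \<le> upper P X"
  shows "z \<le> H_fun \<Omega> A v B X"
proof -
  \<comment> \<open>The terms free of the partition, with the sign for which
    \<open>upper P X\<close> is half the cost minus \<open>?r\<close>.\<close>
  let ?r = "1/2 * (\<Sum>i\<in>UNIV. v $ i * (anorm (A $ i) (X $ i))\<^sup>2) - (\<Sum>i\<in>UNIV. v $ i * (X $ i \<bullet> (A $ i *v B $ i)))"
  obtain X' :: "real^'d^'n" where "X' \<in> distinct_seeds"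
    using distinct_seeds_nonempty by blast
  then have "volume_partitions \<Omega> v \<noteq> {}"
    using ex_volume_partition by blast
  then have "2 * (z + ?r) \<le> transport_cost \<Omega> A X v"
    unfolding transport_cost_def
  proof (rule cINF_greatest)
    fix P assume "P \<in> volume_partitions \<Omega> v"
    from assms[OF this] show "2 * (z + ?r) \<le> (\<Sum>i\<in>UNIV. LINT x:P i|lebesgue. cost X i x)"
      by (simp add: upper_def algebra_simps)
  qed
  then show ?thesis by (simp add: H_fun_def)
qed

lemma concave_H_fun: "concave_on UNIV (H_fun \<Omega> A v B)"
  unfolding concave_on_iff
proof (intro conjI ballI allI impI)
  fix X Y :: "real^'d^'n" and s t :: real
  assume st: "0 \<le> s" "0 \<le> t" "s + t = 1"
  show "s * H_fun \<Omega> A v B X + t * H_fun \<Omega> A v B Y \<le> H_fun \<Omega> A v B (s *\<^sub>R X + t *\<^sub>R Y)"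
  proof (rule H_fun_greatest)
    fix P assume P: "P \<in> volume_partitions \<Omega> v"
    have "s * H_fun \<Omega> A v B X + t * H_fun \<Omega> A v B Y \<le> s * upper P X + t * upper P Y"
      using st P by (intro add_mono mult_left_mono H_fun_le_upper)
    also have "\<dots> = upper P (s *\<^sub>R X + t *\<^sub>R Y)"
    proof -
      \<comment> \<open>The constant part \<open>c\<close> is the same at \<open>X\<close> and
        \<open>Y\<close> and is recovered because \<open>s + t = 1\<close>.\<close>
      have "s * (c + a) + t * (c + b) = c + (s * a + t * b)" for a b c :: real
      proof -
        have "s * (c + a) + t * (c + b) = (s + t) * c + (s * a + t * b)"
          by (simp add: algebra_simps)
        then show ?thesis using st(3) by simp
      qed
      then show ?thesis
        by (simp only: upper_affine[OF volume_partitionsD(1-3)[OF P]] inner_add_right inner_scaleR_right)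
    qed
    finally show "s * H_fun \<Omega> A v B X + t * H_fun \<Omega> A v B Y \<le> upper P (s *\<^sub>R X + t *\<^sub>R Y)" .
  qed
qed simp

section \<open>Supergradients and critical points at distinct seeds\<close>

abbreviation "opt_cells \<equiv> \<lambda>X i. optimal_cell \<Omega> A X v i"

lemma optimal_cellD:
  "optimal_cell \<Omega> A X v i \<in> sets lebesgue" "optimal_cell \<Omega> A X v i \<subseteq> \<Omega>"
  unfolding optimal_cell_def by (rule cell_measurable cell_subset)+

text \<open>The cells are frozen at \<open>X\<close> while the seeds \<open>Y\<close> vary freely. A
  disjoint version of the cells is an admissible partition with the same integrals.\<close>

lemma H_fun_le_upper_optimal:
  assumes X: "X \<in> distinct_seeds"
  shows "H_fun \<Omega> A v B Y \<le> upper (opt_cells X) Y"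
proof -
  obtain P where P: "P \<in> volume_partitions \<Omega> v"
    and ae: "\<And>i. AE x in lebesgue. x \<in> P i \<longleftrightarrow> x \<in> optimal_cell \<Omega> A X v i"
    using ex_volume_partition[OF X] by blast
  have "(LINT x:P i|lebesgue. cost Y i x) = (LINT x:optimal_cell \<Omega> A X v i|lebesgue. cost Y i x)" for i
    by (intro set_integral_cong_set_AE[OF cost_integrable] volume_partitionsD[OF P] optimal_cellD ae)
  then show ?thesis
    using H_fun_le_upper[OF P, of Y] by (simp add: upper_def)
qed

lemma H_fun_eq_upper:
  assumes X: "X \<in> distinct_seeds"
  shows "H_fun \<Omega> A v B X = upper (opt_cells X) X"
proof (rule antisym[OF H_fun_le_upper_optimal[OF X] H_fun_greatest])
  fix P assume P: "P \<in> volume_partitions \<Omega> v"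
  have "(\<Sum>i\<in>UNIV. LINT x:optimal_cell \<Omega> A X v i|lebesgue. cost X i x) \<le> (\<Sum>i\<in>UNIV. LINT x:P i|lebesgue. cost X i x)"
    using cells_optimal[OF X volume_partitionsD(4)[OF P]] vol_optimal_cell[OF X] volume_partitionsD(3)[OF P]
    unfolding optimal_cell_def by simp
  then show "upper (opt_cells X) X \<le> upper P X"
    by (simp add: upper_def)
qed

text \<open>The affine function given by the cells of \<open>X\<close> lies above
  \<open>H_fun\<close> everywhere and touches it at \<open>X\<close>.\<close>

lemma H_fun_supergradient:
  assumes X: "X \<in> distinct_seeds"
  shows "H_fun \<Omega> A v B Y \<le> H_fun \<Omega> A v B X + slope (opt_cells X) \<bullet> (Y - X)"
  using H_fun_le_upper_optimal[OF X, of Y]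
  by (simp add: H_fun_eq_upper[OF X] upper_affine optimal_cellD vol_optimal_cell[OF X] inner_diff_right)

lemma continuous_slope: "continuous_on distinct_seeds (\<lambda>X. slope (opt_cells X))"
  unfolding slope_def
  by (intro continuous_on_vec_lambda bounded_linear.continuous_on[OF matrix_vector_mul_bounded_linear]
      continuous_intros continuous_optimal_cell_integral id_integrable)

lemma GDERIV_H_fun:
  assumes "X \<in> distinct_seeds"
  shows "GDERIV (H_fun \<Omega> A v B) X :> slope (opt_cells X)"
  by (rule GDERIV_if_continuous_supergradient[OF open_distinct_seeds assms continuous_slope H_fun_supergradient])

text \<open>The first moment of a cell is its volume, here \<open>v $ i\<close>, times its
  centroid.\<close>

lemma slope_nth:
  assumes X: "X \<in> distinct_seeds"
  shows "slope (opt_cells X) $ i = v $ i *\<^sub>R (A $ i *v (B $ i - cell_centroid \<Omega> A X v i))"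
proof -
  have "(LINT x:optimal_cell \<Omega> A X v i|lebesgue. x) = v $ i *\<^sub>R cell_centroid \<Omega> A X v i"
    using v_pos[of i] by (simp add: cell_centroid_def centroid_def vol_optimal_cell[OF X])
  then show ?thesis
    by (simp add: slope_def matrix_vector_mult_scaleR matrix_vector_mult_diff_distrib scaleR_diff_right)
qed

text \<open>Positive-definite matrices are injective and the volumes are positive.\<close>

lemma slope_eq_0_iff:
  assumes X: "X \<in> distinct_seeds"
  shows "slope (opt_cells X) = 0 \<longleftrightarrow> (\<forall>i. cell_centroid \<Omega> A X v i = B $ i)"
proof -
  have inj: "A $ i *v y = 0 \<longleftrightarrow> y = 0" for i y
    using spd[of i] by (auto simp: sym_pos_def_def)
  have "v $ i \<noteq> 0" for i using v_pos[of i] by simp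
  then show ?thesis
    by (auto simp: vec_eq_iff[of "slope (opt_cells X)"] slope_nth[OF X] inj)
qed

text \<open>The definition admits any weights; all those with cell volumes \<open>v\<close> give the
  same cells up to null sets and so the same centroids.\<close>

lemma generates_tessellation_iff:
  assumes X: "X \<in> distinct_seeds"
  shows "generates_tessellation \<Omega> A X v B \<longleftrightarrow> (\<forall>i. cell_centroid \<Omega> A X v i = B $ i)"
proof
  assume "generates_tessellation \<Omega> A X v B"
  then obtain w where w: "\<And>i. vol (cell X w i) = v $ i" "\<And>i. centroid (cell X w i) = B $ i"
    by (auto simp: generates_tessellation_def)
  show "\<forall>i. cell_centroid \<Omega> A X v i = B $ i"
    unfolding cell_centroid_def w(2)[symmetric]
    by (simp add: centroid_def optimal_cell_integral_eq[OF X w(1) id_integrable] w(1) vol_optimal_cell[OF X])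
next
  assume "\<forall>i. cell_centroid \<Omega> A X v i = B $ i"
  then show "generates_tessellation \<Omega> A X v B"
    unfolding generates_tessellation_def cell_centroid_def
    using vol_optimal_cell[OF X] by (auto simp: optimal_cell_def)
qed

end

theorem theorem6p2:
  fixes \<Omega> :: "(real^'d) set"
    and A :: "real^'d^'d^'n"
    and v :: "real^'n"
    and B :: "real^'d^'n"
  assumes "CARD('d) \<ge> 2"
    and "\<Omega> \<noteq> {}" and "convex \<Omega>" and "bounded \<Omega>" and "\<Omega> = closure (interior \<Omega>)"
    and "(v, B) \<in> compatible_data \<Omega>"
    and "\<forall>i. sym_pos_def (A $ i)"
  shows "(\<forall>X\<in>distinct_seeds.
            H_fun \<Omega> A v B X =
              1/2 * (\<Sum>i\<in>UNIV. LINT x:optimal_cell \<Omega> A X v i|lebesgue. (anorm (A $ i) (x - X $ i))\<^sup>2)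
              - 1/2 * (\<Sum>i\<in>UNIV. v $ i * (anorm (A $ i) (X $ i))\<^sup>2)
              + (\<Sum>i\<in>UNIV. v $ i * (X $ i \<bullet> (A $ i *v B $ i))))
       \<and> concave_on UNIV (H_fun \<Omega> A v B)
       \<and> continuously_differentiable_on (H_fun \<Omega> A v B) distinct_seeds
       \<and> (\<forall>X\<in>distinct_seeds. \<forall>i.
            gradient (H_fun \<Omega> A v B) X $ i =
              v $ i *\<^sub>R (A $ i *v (B $ i - cell_centroid \<Omega> A X v i)))
       \<and> (\<forall>X\<in>distinct_seeds.
            (gradient (H_fun \<Omega> A v B) X = 0 \<longleftrightarrow> generates_tessellation \<Omega> A X v B) \<and>
            (generates_tessellation \<Omega> A X v B \<longleftrightarrow> (\<forall>i. cell_centroid \<Omega> A X v i = B $ i)))"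
proof -
  \<comment> \<open>A closure is closed; with boundedness this gives the compactness that the locale
    asks for.\<close>
  have "closed \<Omega>" using assms(5) closed_closure by metis
  then interpret laguerre_data \<Omega> A v B
    using assms(4,6,7)
    by unfold_locales (auto simp: compact_eq_bounded_closed compatible_data_def volume_vectors_def)
  have grad: "gradient (H_fun \<Omega> A v B) X = slope (opt_cells X)" if "X \<in> distinct_seeds" for X
    by (rule gradient_eqI[OF GDERIV_H_fun[OF that]])
  have "continuous_on distinct_seeds (gradient (H_fun \<Omega> A v B))"
    using continuous_slope by (simp cong: continuous_on_cong add: grad)
  moreover have "H_fun \<Omega> A v B differentiable (at X)" if "X \<in> distinct_seeds" for X
    using GDERIV_H_fun[OF that] unfolding gderiv_def by (rule differentiableI)
  ultimately have "continuously_differentiable_on (H_fun \<Omega> A v B) distinct_seeds"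
    by (simp add: continuously_differentiable_on_def)
  then show ?thesis
    using H_fun_eq_upper concave_H_fun
    by (simp add: grad slope_nth slope_eq_0_iff generates_tessellation_iff upper_def)
qed

end
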